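(* Let the semigroup $G$ of continuous self-maps of a compact metric space $X$ be generated by the finite set $G_1=\{\mathrm{id}_X,f_1,\dots,f_m\}$, and let $\mu$ be a Borel probability measure on $X$. Assume that $Y\subset X$ is a Borel set with $\mu(Y)>0$, and that for some $\alpha>0$ $$h^l_\mu(x,G_1)\ge\alpha>0\quad\text{for every }x\in Y.$$ Then for every trajectory $\omega\in\Sigma_m^+$, $h(Y,G_1,\omega)\ge\alpha$. Moreover, $h^A(Y,G_1)\ge\alpha$.
   Context: Let $(X,d)$ be a compact metric space, $f_1,\dots,f_m:X\to X$ continuous, $f_{j_1\dots j_n}:=f_{j_1}\circ\dots\circ f_{j_n}$. $\Sigma_m^*$ is the set of finite words $C=(i_1,\dots,i_n)$, $n\ge1$, over $\{1,\dots,m\}$, with length $n(C)=|C|=n$; $\Sigma_m^+$ is the space of sequences $\omega=(\omega_0,\omega_1,\dots)$ over $\{1,\dots,m\}$. For $C=(i_1,\dots,i_n)$, $$B_n(y,C,\varepsilon)=\{z\in X: d(y,z)<\varepsilon,\ d(f_{i_k\dots i_1}(y),f_{i_k\dots i_1}(z))<\varepsilon,\ 1\le k\le n\},$$ and $B_n(y,\omega,\varepsilon)=B_n(y,(\omega_0,\dots,\omega_{n-1}),\varepsilon)$ for $\omega\in\Sigma_m^+$. Lower local amalgamated entropy of $\mu$ at $x$ (with $\log 0^{-1}=+\infty$): $$h_\mu^l(x,G_1)=\lim_{\varepsilon\to0}\liminf_{n\to\infty}\inf_{|C|=n}\frac{\log\mu(B_n(x,C,\varepsilon))^{-1}}{n}.$$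 Amalgamated topological entropy $h^A(Y,G_1)$: let $M(\lambda,Y,N,\varepsilon)=\inf_\Gamma\sum_{(C,y)\in\Gamma}e^{-\lambda n(C)}$, the infimum over at most countable $\Gamma\subset\Sigma_m^*\times X$ with $Y\subset\bigcup_{(C,y)\in\Gamma}B_{n(C)}(y,C,\varepsilon)$ and $n(C)\ge N$ for all $(C,y)\in\Gamma$; $m(\lambda,Y,\varepsilon)=\lim_{N\to\infty}M(\lambda,Y,N,\varepsilon)$; $h^A(Y,G_1,\varepsilon)=\inf\{\lambda:m(\lambda,Y,\varepsilon)=0\}$; $h^A(Y,G_1)=\lim_{\varepsilon\to0}h^A(Y,G_1,\varepsilon)$. Topological entropy on $Y$ along $\omega$, $h(Y,G_1,\omega)$: defined by the same procedure from $M_\omega(\lambda,Y,N,\varepsilon)=\inf\sum_{y\in\Gamma}e^{-\lambda n}$, the infimum over at most countable $\Gamma\subset Y$ with integers $n=n(y)\ge N$ such that $Y\subset\bigcup_{y\in\Gamma}B_n(y,\omega,\varepsilon)$. *)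

theory Defs
  imports "HOL-Probability.Probability"
begin

definition words :: "nat \<Rightarrow> nat list set" where
  "words m = {C. C \<noteq> [] \<and> set C \<subseteq> {1..m}}"

definition trajectories :: "nat \<Rightarrow> (nat \<Rightarrow> nat) set" where
  "trajectories m = {\<omega>. \<forall>i. \<omega> i \<in> {1..m}}"

text \<open>\<open>comp_word f [j\<^sub>1, \<dots>, j\<^sub>n]\<close> is \<open>f j\<^sub>1 \<circ> \<dots> \<circ> f j\<^sub>n\<close>, so the last letter acts first.\<close>

definition comp_word :: "(nat \<Rightarrow> 'a \<Rightarrow> 'a) \<Rightarrow> nat list \<Rightarrow> 'a \<Rightarrow> 'a" where
  "comp_word f js = foldr (\<lambda>j g. f j \<circ> g) js id"

text \<open>For a word \<open>C = (i\<^sub>1, \<dots>, i\<^sub>n)\<close> the maps in the ball are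
  \<open>f i\<^sub>k \<circ> \<dots> \<circ> f i\<^sub>1\<close>; hence the reversed prefixes. The length \<open>n\<close> is \<open>length C\<close>.\<close>

definition bowen_ball :: "(nat \<Rightarrow> 'a::metric_space \<Rightarrow> 'a) \<Rightarrow> 'a \<Rightarrow> nat list \<Rightarrow> real \<Rightarrow> 'a set" where
  "bowen_ball f y C \<epsilon> =
     {z. dist y z < \<epsilon> \<and>
         (\<forall>k\<in>{1..length C}.
            dist (comp_word f (rev (take k C)) y) (comp_word f (rev (take k C)) z) < \<epsilon>)}"

definition bowen_ball_along ::
    "(nat \<Rightarrow> 'a::metric_space \<Rightarrow> 'a) \<Rightarrow> nat \<Rightarrow> 'a \<Rightarrow> (nat \<Rightarrow> nat) \<Rightarrow> real \<Rightarrow> 'a set" where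
  "bowen_ball_along f n y \<omega> \<epsilon> = bowen_ball f y (map \<omega> [0..<n]) \<epsilon>"

definition log_inverse :: "real \<Rightarrow> ereal" where
  "log_inverse p = (if p = 0 then \<infinity> else ereal (ln (inverse p)))"

definition lower_local_entropy ::
    "'a::metric_space measure \<Rightarrow> nat \<Rightarrow> (nat \<Rightarrow> 'a \<Rightarrow> 'a) \<Rightarrow> 'a \<Rightarrow> ereal" where
  "lower_local_entropy \<mu> m f x =
     Lim (at_right 0) (\<lambda>\<epsilon>. liminf (\<lambda>n.
       INF C\<in>{C \<in> words m. length C = n}.
         log_inverse (measure \<mu> (bowen_ball f x C \<epsilon>)) / ereal (real n)))"

definition covers_amalg ::
    "nat \<Rightarrow> (nat \<Rightarrow> 'a::metric_space \<Rightarrow> 'a) \<Rightarrow> 'a set \<Rightarrow> nat \<Rightarrow> real \<Rightarrow> (nat list \<times> 'a) set set" where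
  "covers_amalg m f Y N \<epsilon> =
     {\<Gamma>. countable \<Gamma> \<and> \<Gamma> \<subseteq> words m \<times> UNIV \<and>
         Y \<subseteq> (\<Union>(C, y)\<in>\<Gamma>. bowen_ball f y C \<epsilon>) \<and> (\<forall>(C, y)\<in>\<Gamma>. N \<le> length C)}"

definition M_amalg ::
    "nat \<Rightarrow> (nat \<Rightarrow> 'a::metric_space \<Rightarrow> 'a) \<Rightarrow> real \<Rightarrow> 'a set \<Rightarrow> nat \<Rightarrow> real \<Rightarrow> ennreal" where
  "M_amalg m f s Y N \<epsilon> =
     (INF \<Gamma>\<in>covers_amalg m f Y N \<epsilon>.
        \<Sum>\<^sub>\<infinity>(C, y)\<in>\<Gamma>. ennreal (exp (- s * real (length C))))"

definition m_amalg ::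
    "nat \<Rightarrow> (nat \<Rightarrow> 'a::metric_space \<Rightarrow> 'a) \<Rightarrow> real \<Rightarrow> 'a set \<Rightarrow> real \<Rightarrow> ennreal" where
  "m_amalg m f s Y \<epsilon> = lim (\<lambda>N. M_amalg m f s Y N \<epsilon>)"

definition entropy_amalg_eps ::
    "nat \<Rightarrow> (nat \<Rightarrow> 'a::metric_space \<Rightarrow> 'a) \<Rightarrow> 'a set \<Rightarrow> real \<Rightarrow> ereal" where
  "entropy_amalg_eps m f Y \<epsilon> = Inf (ereal ` {s. m_amalg m f s Y \<epsilon> = 0})"

definition entropy_amalg ::
    "nat \<Rightarrow> (nat \<Rightarrow> 'a::metric_space \<Rightarrow> 'a) \<Rightarrow> 'a set \<Rightarrow> ereal" where
  "entropy_amalg m f Y = Lim (at_right 0) (entropy_amalg_eps m f Y)"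

text \<open>A cover along \<open>\<omega>\<close> is a set of centres in \<open>Y\<close> together with a time \<open>\<nu> y\<close> for each centre.\<close>

definition covers_along ::
    "(nat \<Rightarrow> 'a::metric_space \<Rightarrow> 'a) \<Rightarrow> (nat \<Rightarrow> nat) \<Rightarrow> 'a set \<Rightarrow> nat \<Rightarrow> real
      \<Rightarrow> ('a set \<times> ('a \<Rightarrow> nat)) set" where
  "covers_along f \<omega> Y N \<epsilon> =
     {(\<Gamma>, \<nu>). countable \<Gamma> \<and> \<Gamma> \<subseteq> Y \<and> (\<forall>y\<in>\<Gamma>. N \<le> \<nu> y) \<and>
              Y \<subseteq> (\<Union>y\<in>\<Gamma>. bowen_ball_along f (\<nu> y) y \<omega> \<epsilon>)}"

definition M_along ::
    "(nat \<Rightarrow> 'a::metric_space \<Rightarrow> 'a) \<Rightarrow> (nat \<Rightarrow> nat) \<Rightarrow> real \<Rightarrow> 'a set \<Rightarrow> nat \<Rightarrow> real \<Rightarrow> ennreal" where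
  "M_along f \<omega> s Y N \<epsilon> =
     (INF (\<Gamma>, \<nu>)\<in>covers_along f \<omega> Y N \<epsilon>. \<Sum>\<^sub>\<infinity>y\<in>\<Gamma>. ennreal (exp (- s * real (\<nu> y))))"

definition m_along ::
    "(nat \<Rightarrow> 'a::metric_space \<Rightarrow> 'a) \<Rightarrow> (nat \<Rightarrow> nat) \<Rightarrow> real \<Rightarrow> 'a set \<Rightarrow> real \<Rightarrow> ennreal" where
  "m_along f \<omega> s Y \<epsilon> = lim (\<lambda>N. M_along f \<omega> s Y N \<epsilon>)"

definition entropy_along_eps ::
    "(nat \<Rightarrow> 'a::metric_space \<Rightarrow> 'a) \<Rightarrow> (nat \<Rightarrow> nat) \<Rightarrow> 'a set \<Rightarrow> real \<Rightarrow> ereal" where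
  "entropy_along_eps f \<omega> Y \<epsilon> = Inf (ereal ` {s. m_along f \<omega> s Y \<epsilon> = 0})"

definition entropy_along ::
    "(nat \<Rightarrow> 'a::metric_space \<Rightarrow> 'a) \<Rightarrow> (nat \<Rightarrow> nat) \<Rightarrow> 'a set \<Rightarrow> ereal" where
  "entropy_along f \<omega> Y = Lim (at_right 0) (entropy_along_eps f \<omega> Y)"

text \<open>All limits above exist by monotonicity, so \<open>lim\<close> and \<open>Lim\<close> never denote an unspecified value;
  for the local entropy this uses continuity of the maps, which makes the balls Borel.\<close>

lemma bowen_ball_mono: "\<epsilon> \<le> \<epsilon>' \<Longrightarrow> bowen_ball f y C \<epsilon> \<subseteq> bowen_ball f y C \<epsilon>'"
  by (force simp: bowen_ball_def)

lemma tendsto_SUP_at_right_0: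
  fixes g :: "real \<Rightarrow> ereal"
  assumes "\<And>a b. 0 < a \<Longrightarrow> a \<le> b \<Longrightarrow> g b \<le> g a"
  shows "(g \<longlongrightarrow> (SUP \<epsilon>\<in>{0<..}. g \<epsilon>)) (at_right 0)"
proof (rule order_tendstoI)
  fix a assume "a < (SUP \<epsilon>\<in>{0<..}. g \<epsilon>)"
  then obtain e where e: "e > 0" "a < g e" by (auto simp: less_SUP_iff)
  have "\<forall>\<^sub>F x in at_right 0. x \<in> {0<..<e}"
    using e eventually_at_right_real by blast
  then show "\<forall>\<^sub>F x in at_right 0. a < g x"
    by eventually_elim (use e assms in \<open>auto intro: less_le_trans less_imp_le\<close>)
next
  fix a assume a: "(SUP \<epsilon>\<in>{0<..}. g \<epsilon>) < a"
  have "\<forall>\<^sub>F x in at_right (0::real). x > 0" by (rule eventually_at_right_less)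
  then show "\<forall>\<^sub>F x in at_right 0. g x < a"
  proof eventually_elim
    case (elim x)
    then have "g x \<le> (SUP \<epsilon>\<in>{0<..}. g \<epsilon>)" by (intro SUP_upper) auto
    then show ?case using a by order
  qed
qed

lemma M_amalg_mono_N: "N \<le> N' \<Longrightarrow> M_amalg m f s Y N \<epsilon> \<le> M_amalg m f s Y N' \<epsilon>"
  unfolding M_amalg_def by (rule INF_superset_mono) (fastforce simp: covers_amalg_def)+

lemma M_along_mono_N: "N \<le> N' \<Longrightarrow> M_along f \<omega> s Y N \<epsilon> \<le> M_along f \<omega> s Y N' \<epsilon>"
  unfolding M_along_def by (rule INF_superset_mono) (fastforce simp: covers_along_def)+

lemma M_amalg_antimono_eps:
  assumes "\<epsilon> \<le> \<epsilon>'" shows "M_amalg m f s Y N \<epsilon>' \<le> M_amalg m f s Y N \<epsilon>"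
proof -
  have "covers_amalg m f Y N \<epsilon> \<subseteq> covers_amalg m f Y N \<epsilon>'"
    using bowen_ball_mono[OF assms, of f] unfolding covers_amalg_def by (clarsimp, blast)
  then show ?thesis unfolding M_amalg_def by (rule INF_superset_mono) simp
qed

lemma M_along_antimono_eps:
  assumes "\<epsilon> \<le> \<epsilon>'" shows "M_along f \<omega> s Y N \<epsilon>' \<le> M_along f \<omega> s Y N \<epsilon>"
proof -
  have "covers_along f \<omega> Y N \<epsilon> \<subseteq> covers_along f \<omega> Y N \<epsilon>'"
    using bowen_ball_mono[OF assms, of f] unfolding covers_along_def bowen_ball_along_def
    by (clarsimp, blast)
  then show ?thesis unfolding M_along_def by (rule INF_superset_mono) simp
qed

lemma M_amalg_tendsto: "(\<lambda>N. M_amalg m f s Y N \<epsilon>) \<longlonglongrightarrow> m_amalg m f s Y \<epsilon>"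
  unfolding m_amalg_def convergent_LIMSEQ_iff[symmetric]
  by (rule convergentI[OF LIMSEQ_SUP]) (auto simp: incseq_def M_amalg_mono_N)

lemma M_along_tendsto: "(\<lambda>N. M_along f \<omega> s Y N \<epsilon>) \<longlonglongrightarrow> m_along f \<omega> s Y \<epsilon>"
  unfolding m_along_def convergent_LIMSEQ_iff[symmetric]
  by (rule convergentI[OF LIMSEQ_SUP]) (auto simp: incseq_def M_along_mono_N)

lemma entropy_amalg_eps_antimono:
  assumes "\<epsilon> \<le> \<epsilon>'" shows "entropy_amalg_eps m f Y \<epsilon>' \<le> entropy_amalg_eps m f Y \<epsilon>"
proof -
  have "m_amalg m f s Y \<epsilon>' \<le> m_amalg m f s Y \<epsilon>" for s
    by (rule LIMSEQ_le[OF M_amalg_tendsto M_amalg_tendsto])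
       (use M_amalg_antimono_eps[OF assms] in blast)
  then have "m_amalg m f s Y \<epsilon> = 0 \<Longrightarrow> m_amalg m f s Y \<epsilon>' = 0" for s
    by (metis le_zero_eq)
  then show ?thesis unfolding entropy_amalg_eps_def by (intro Inf_superset_mono) auto
qed

lemma entropy_along_eps_antimono:
  assumes "\<epsilon> \<le> \<epsilon>'" shows "entropy_along_eps f \<omega> Y \<epsilon>' \<le> entropy_along_eps f \<omega> Y \<epsilon>"
proof -
  have "m_along f \<omega> s Y \<epsilon>' \<le> m_along f \<omega> s Y \<epsilon>" for s
    by (rule LIMSEQ_le[OF M_along_tendsto M_along_tendsto])
       (use M_along_antimono_eps[OF assms] in blast)
  then have "m_along f \<omega> s Y \<epsilon> = 0 \<Longrightarrow> m_along f \<omega> s Y \<epsilon>' = 0" for s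
    by (metis le_zero_eq)
  then show ?thesis unfolding entropy_along_eps_def by (intro Inf_superset_mono) auto
qed

lemma entropy_amalg_eps_tendsto:
  "(entropy_amalg_eps m f Y \<longlongrightarrow> entropy_amalg m f Y) (at_right 0)"
  using tendsto_SUP_at_right_0[of "entropy_amalg_eps m f Y"] entropy_amalg_eps_antimono
  unfolding entropy_amalg_def by (metis tendsto_Lim trivial_limit_at_right_real)

lemma entropy_along_eps_tendsto:
  "(entropy_along_eps f \<omega> Y \<longlongrightarrow> entropy_along f \<omega> Y) (at_right 0)"
  using tendsto_SUP_at_right_0[of "entropy_along_eps f \<omega> Y"] entropy_along_eps_antimono
  unfolding entropy_along_def by (metis tendsto_Lim trivial_limit_at_right_real)

lemma log_inverse_antimono:
  assumes "0 \<le> p" "p \<le> q" shows "log_inverse q \<le> log_inverse p"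
  using assms by (auto simp: log_inverse_def ln_inverse)

lemma continuous_comp_word:
  fixes f :: "nat \<Rightarrow> 'a::topological_space \<Rightarrow> 'a"
  assumes "\<And>i. i \<in> set js \<Longrightarrow> continuous_on UNIV (f i)"
  shows "continuous_on UNIV (comp_word f js)"
  using assms
proof (induction js)
  case (Cons j js)
  then have "continuous_on UNIV (f j \<circ> comp_word f js)"
    by (intro continuous_on_compose) (auto intro: continuous_on_subset)
  then show ?case by (simp add: comp_word_def)
qed (simp add: comp_word_def id_def)

lemma open_bowen_ball:
  fixes f :: "nat \<Rightarrow> 'a::metric_space \<Rightarrow> 'a"
  assumes "\<And>i. i \<in> set C \<Longrightarrow> continuous_on UNIV (f i)"
  shows "open (bowen_ball f y C \<epsilon>)"
proof -
  have c: "continuous_on UNIV (comp_word f (rev (take k C)))" for k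
    by (rule continuous_comp_word) (use assms in \<open>auto dest: in_set_takeD\<close>)
  have "bowen_ball f y C \<epsilon> = {z. dist y z < \<epsilon>} \<inter>
      (\<Inter>k\<in>{1..length C}. {z. dist (comp_word f (rev (take k C)) y) (comp_word f (rev (take k C)) z) < \<epsilon>})"
    by (auto simp: bowen_ball_def)
  also have "open \<dots>"
    by (intro open_Int open_INT ballI open_Collect_less continuous_intros c) auto
  finally show ?thesis .
qed

lemma lower_local_entropy_tendsto:
  fixes f :: "nat \<Rightarrow> 'a::metric_space \<Rightarrow> 'a"
  assumes "prob_space \<mu>" "sets \<mu> = sets borel"
    and "\<And>i. i \<in> {1..m} \<Longrightarrow> continuous_on UNIV (f i)"
  shows "((\<lambda>\<epsilon>. liminf (\<lambda>n. INF C\<in>{C \<in> words m. length C = n}.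
            log_inverse (measure \<mu> (bowen_ball f x C \<epsilon>)) / ereal (real n)))
          \<longlongrightarrow> lower_local_entropy \<mu> m f x) (at_right 0)"
proof -
  interpret prob_space \<mu> by fact
  let ?g = "\<lambda>\<epsilon>. liminf (\<lambda>n. INF C\<in>{C \<in> words m. length C = n}.
            log_inverse (measure \<mu> (bowen_ball f x C \<epsilon>)) / ereal (real n))"
  have "?g b \<le> ?g a" if "a \<le> b" for a b
  proof (intro Liminf_mono always_eventually allI INF_mono)
    fix n C assume C: "C \<in> {C \<in> words m. length C = n}"
    then have "bowen_ball f x C b \<in> sets \<mu>"
      using assms open_bowen_ball[of C f] by (auto simp: words_def subset_eq)
    then have "log_inverse (measure \<mu> (bowen_ball f x C b)) \<le> log_inverse (measure \<mu> (bowen_ball f x C a))"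
      by (intro log_inverse_antimono finite_measure_mono bowen_ball_mono that) auto
    moreover have "n > 0" using C by (auto simp: words_def)
    ultimately show "\<exists>C'\<in>{C \<in> words m. length C = n}.
        log_inverse (measure \<mu> (bowen_ball f x C' b)) / ereal (real n)
          \<le> log_inverse (measure \<mu> (bowen_ball f x C a)) / ereal (real n)"
      using C by (intro bexI[of _ C] ereal_divide_right_mono) auto
  qed
  then have "(?g \<longlongrightarrow> (SUP \<epsilon>\<in>{0<..}. ?g \<epsilon>)) (at_right 0)"
    by (intro tendsto_SUP_at_right_0) auto
  then show ?thesis
    unfolding lower_local_entropy_def by (metis (no_types, lifting) tendsto_Lim trivial_limit_at_right_real)
qed

end

theory Submission imports Defs begin

text \<open>Mass distribution principle. Fix \<open>\<lambda> < \<alpha>\<close>. The set \<open>Y\<close> is the countable union over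
  \<open>k\<close> of the points \<open>x\<close> for which every Bowen ball of radius \<open>1/(k+1)\<close> around \<open>x\<close> along a word of
  length \<open>n \<ge> k\<close> has measure at most \<open>e\<close> to the power \<open>-\<lambda>n\<close>. One of these sets has positive outer
  measure \<open>c\<close>. A ball of half that radius meeting it lies in such a ball, so every cover of \<open>Y\<close> by
  balls of half the radius and length at least \<open>k\<close> has weight at least \<open>c\<close>. Covers along a trajectory are
  particular amalgamated covers, which gives the statement for trajectories. Working with outer
  measure avoids proving that the pieces of \<open>Y\<close> are Borel.\<close>

section \<open>Countable covers and outer measure\<close>

text \<open>Countable subadditivity in the form of the cover weights: finite subfamilies are bounded
  by finite partial sums of \<open>infsum\<close>, and continuity from below passes to the
  union.\<close>

lemma emeasure_UN_le_infsum:
  fixes g :: "'i \<Rightarrow> ennreal"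
  assumes "countable I" and A: "\<And>i. i \<in> I \<Longrightarrow> A i \<in> sets M"
    and le: "\<And>i. i \<in> I \<Longrightarrow> emeasure M (A i) \<le> g i"
  shows "emeasure M (\<Union>i\<in>I. A i) \<le> (\<Sum>\<^sub>\<infinity>i\<in>I. g i)"
proof (cases "I = {}")
  case False
  let ?e = "from_nat_into I"
  \<comment> \<open>The enumeration \<open>?e\<close> repeats elements when \<open>I\<close> is
    finite; using images of initial segments counts each index once.\<close>
  let ?U = "\<lambda>n. \<Union>i\<in>?e ` {..<n}. A i"
  have e: "?e n \<in> I" for n using False by (simp add: from_nat_into)
  have "I = (\<Union>n. ?e ` {..<n})"
    using range_from_nat_into[OF False assms(1)] by (simp flip: image_UN add: UN_lessThan_UNIV)
  then have "(\<Union>i\<in>I. A i) = (\<Union>n. ?U n)" by (metis UN_UN_flatten)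
  also have "emeasure M \<dots> = (SUP n. emeasure M (?U n))"
    by (rule SUP_emeasure_incseq[symmetric]) (use A e in \<open>auto intro!: incseq_SucI simp: lessThan_Suc\<close>)
  also have "\<dots> \<le> (\<Sum>\<^sub>\<infinity>i\<in>I. g i)"
  proof (rule SUP_least)
    fix n
    have "emeasure M (?U n) \<le> (\<Sum>i\<in>?e ` {..<n}. emeasure M (A i))"
      using A e by (intro emeasure_subadditive_finite) auto
    also have "\<dots> \<le> (\<Sum>i\<in>?e ` {..<n}. g i)" using le e by (intro sum_mono) auto
    also have "\<dots> \<le> (\<Sum>\<^sub>\<infinity>i\<in>I. g i)"
      using e by (subst nonneg_infsum_complete) (auto intro!: SUP_upper)
    finally show "emeasure M (?U n) \<le> (\<Sum>\<^sub>\<infinity>i\<in>I. g i)" .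
  qed
  finally show ?thesis .
qed simp

text \<open>The hypothesis expresses outer measure 0; intersecting supersets of measure below
  1/(n+1) gives one measurable null superset.\<close>

lemma null_set_superset_if_small_supersets:
  assumes small: "\<And>c. c > 0 \<Longrightarrow> \<exists>U\<in>sets M. A \<subseteq> U \<and> emeasure M U < c"
  shows "\<exists>U\<in>null_sets M. A \<subseteq> U"
proof -
  have "\<exists>U\<in>sets M. A \<subseteq> U \<and> emeasure M U < ennreal (1 / Suc n)" for n
    by (rule small) simp
  then obtain U where U: "\<And>n. U n \<in> sets M" "\<And>n. A \<subseteq> U n" "\<And>n. emeasure M (U n) < ennreal (1 / Suc n)"
    by metis
  have "emeasure M (\<Inter>n. U n) \<le> ennreal (1 / Suc n)" for n
    using U emeasure_mono[of "\<Inter>n. U n" "U n" M] by (meson INT_lower UNIV_I less_imp_le order_trans)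
  moreover have "(\<lambda>n. ennreal (1 / Suc n)) \<longlonglongrightarrow> ennreal 0"
    by (intro tendsto_ennrealI lim_1_over_n[THEN LIMSEQ_Suc])
  ultimately have "emeasure M (\<Inter>n. U n) \<le> ennreal 0" by (meson LIMSEQ_le_const)
  then have "(\<Inter>n. U n) \<in> null_sets M" using U(1) by (auto simp: null_sets_def)
  with U(2) show ?thesis by blast
qed

text \<open>If every piece had outer measure 0, null supersets of the pieces would unite to a null
  superset of \<open>Y\<close>. The pieces themselves may be non-measurable.\<close>

lemma positive_outer_measure_piece:
  fixes A :: "nat \<Rightarrow> 'a set"
  assumes "Y \<subseteq> (\<Union>k. A k)" and "emeasure M Y > 0"
  shows "\<exists>k. \<exists>c>0. \<forall>U\<in>sets M. A k \<subseteq> U \<longrightarrow> c \<le> emeasure M U"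
proof (rule ccontr)
  assume "\<not> ?thesis"
  then have "\<exists>U\<in>sets M. A k \<subseteq> U \<and> emeasure M U < c" if "c > 0" for k c
    using that by (meson not_le)
  then have "\<exists>U\<in>null_sets M. A k \<subseteq> U" for k
    by (intro null_set_superset_if_small_supersets)
  then obtain U where U: "\<And>k. U k \<in> null_sets M" "\<And>k. A k \<subseteq> U k" by metis
  then have "(\<Union>k. U k) \<in> null_sets M" by auto
  moreover have "Y \<subseteq> (\<Union>k. U k)" using assms(1) U(2) by blast
  ultimately have "emeasure M Y \<le> 0"
    using emeasure_mono[of Y "\<Union>k. U k" M] by (auto simp: null_sets_def)
  with assms(2) show False by simp
qed

section \<open>Bowen balls and local entropy\<close>

text \<open>The triangle inequality through \<open>y\<close> at each time. Centres of a cover are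
  arbitrary, so balls must be recentred at points with a known measure bound.\<close>

lemma bowen_ball_half_subset:
  fixes f :: "nat \<Rightarrow> 'a::metric_space \<Rightarrow> 'a"
  assumes "x \<in> bowen_ball f y C (\<epsilon> / 2)"
  shows "bowen_ball f y C (\<epsilon> / 2) \<subseteq> bowen_ball f x C \<epsilon>"
proof -
  have tri: "dist u w < \<epsilon>" if "dist v u < \<epsilon> / 2" "dist v w < \<epsilon> / 2" for u v w :: 'a
    using that dist_triangle_half_r by blast
  show ?thesis using assms unfolding bowen_ball_def by (blast intro: tri)
qed

lemma le_exp_if_log_inverse:
  assumes "p \<ge> 0" "n > 0" "ereal t \<le> log_inverse p / ereal (real n)"
  shows "p \<le> exp (- t * real n)"
proof (cases "p = 0")
  case False
  with assms have "t \<le> ln (inverse p) / real n" by (simp add: log_inverse_def)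
  with assms False have "t * real n \<le> - ln p" by (simp add: ln_inverse pos_le_minus_divide_eq)
  then have "ln p \<le> - t * real n" by simp
  with assms False show ?thesis by (metis exp_le_cancel_iff exp_ln less_eq_real_def)
qed simp

text \<open>A single index \<open>k\<close> controls both radius and minimal length, so that
  countably many pieces exhaust \<open>Y\<close>. The infimum over words in the local entropy makes
  the bound uniform in \<open>C\<close>.\<close>

lemma lower_local_entropy_imp_bowen_ball_le:
  fixes f :: "nat \<Rightarrow> 'a::metric_space \<Rightarrow> 'a"
  assumes \<mu>: "prob_space \<mu>" "sets \<mu> = sets borel"
    and cont: "\<And>i. i \<in> {1..m} \<Longrightarrow> continuous_on UNIV (f i)"
    and t: "ereal t < lower_local_entropy \<mu> m f x"
  shows "\<exists>k. \<forall>C\<in>words m. k \<le> length C \<longrightarrow>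
           measure \<mu> (bowen_ball f x C (1 / Suc k)) \<le> exp (- t * real (length C))"
proof -
  let ?a = "\<lambda>\<epsilon> n. INF C\<in>{C \<in> words m. length C = n}.
              log_inverse (measure \<mu> (bowen_ball f x C \<epsilon>)) / ereal (real n)"
  have "\<forall>\<^sub>F \<epsilon> in at_right 0. ereal t < liminf (?a \<epsilon>)"
    using lower_local_entropy_tendsto[OF \<mu> cont] t by (rule order_tendstoD)
  then obtain b where b: "b > 0" "\<And>\<epsilon>. 0 < \<epsilon> \<Longrightarrow> \<epsilon> < b \<Longrightarrow> ereal t < liminf (?a \<epsilon>)"
    unfolding eventually_at_right_field by blast
  define \<delta> where "\<delta> = b / 2"
  have \<delta>: "\<delta> > 0" "ereal t < liminf (?a \<delta>)" using b by (auto simp: \<delta>_def)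
  from less_LiminfD[OF \<delta>(2)] obtain N where N: "\<And>n. n \<ge> N \<Longrightarrow> ereal t < ?a \<delta> n"
    by (auto simp: eventually_sequentially)
  obtain j where j: "1 / Suc j < \<delta>" using nat_approx_posE[OF \<delta>(1)] by blast
  \<comment> \<open>\<open>j\<close> makes the radius at most \<open>\<delta>\<close> and
    \<open>N\<close> makes the lengths large enough; shrinking the radius only decreases the
    measure.\<close>
  define k where "k = max j N"
  have k: "1 / Suc k \<le> \<delta>"
    using j frac_le[of 1 1 "real (Suc j)" "real (Suc k)"] by (auto simp: k_def)
  show ?thesis
  proof (intro exI ballI impI)
    fix C assume C: "C \<in> words m" "k \<le> length C"
    interpret prob_space \<mu> by fact
    have "bowen_ball f x C \<delta> \<in> sets \<mu>"
      using C(1) \<mu>(2) cont open_bowen_ball[of C f] by (auto simp: words_def subset_eq)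
    then have "measure \<mu> (bowen_ball f x C (1 / Suc k)) \<le> measure \<mu> (bowen_ball f x C \<delta>)"
      by (intro finite_measure_mono bowen_ball_mono k)
    also have "\<dots> \<le> exp (- t * real (length C))"
    proof (rule le_exp_if_log_inverse)
      have "ereal t < ?a \<delta> (length C)" using C(2) by (intro N) (auto simp: k_def)
      also have "\<dots> \<le> log_inverse (measure \<mu> (bowen_ball f x C \<delta>)) / ereal (real (length C))"
        using C(1) by (intro INF_lower) auto
      finally show "ereal t \<le> log_inverse (measure \<mu> (bowen_ball f x C \<delta>)) / ereal (real (length C))"
        by simp
    qed (use C(1) in \<open>auto simp: words_def\<close>)
    finally show "measure \<mu> (bowen_ball f x C (1 / Suc k)) \<le> exp (- t * real (length C))" .
  qed
qed

section \<open>Weights of amalgamated covers\<close>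

lemma mass_distribution_M_amalg:
  fixes f :: "nat \<Rightarrow> 'a::metric_space \<Rightarrow> 'a"
  assumes \<mu>: "finite_measure \<mu>" "sets \<mu> = sets borel"
    and cont: "\<And>i. i \<in> {1..m} \<Longrightarrow> continuous_on UNIV (f i)"
    and "A \<subseteq> Y"
    and outer: "\<And>U. U \<in> sets \<mu> \<Longrightarrow> A \<subseteq> U \<Longrightarrow> c \<le> emeasure \<mu> U"
    and small: "\<And>x C. x \<in> A \<Longrightarrow> C \<in> words m \<Longrightarrow> N \<le> length C \<Longrightarrow>
                  measure \<mu> (bowen_ball f x C \<epsilon>) \<le> exp (- s * real (length C))"
  shows "c \<le> M_amalg m f s Y N (\<epsilon> / 2)"
  unfolding M_amalg_def
proof (rule INF_greatest)
  interpret finite_measure \<mu> by fact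
  fix \<Gamma> assume "\<Gamma> \<in> covers_amalg m f Y N (\<epsilon> / 2)"
  then have cov: "countable \<Gamma>" "\<And>C y. (C, y) \<in> \<Gamma> \<Longrightarrow> C \<in> words m \<and> N \<le> length C"
    "Y \<subseteq> (\<Union>(C, y)\<in>\<Gamma>. bowen_ball f y C (\<epsilon> / 2))"
    by (auto simp: covers_amalg_def)
  let ?B = "\<lambda>(C, y). bowen_ball f y C (\<epsilon> / 2)"
  \<comment> \<open>Balls missing \<open>A\<close> have no known measure bound; replacing them by
    the empty set still leaves a cover of \<open>A\<close>.\<close>
  let ?A = "\<lambda>p. if ?B p \<inter> A = {} then {} else ?B p"
  have sets: "bowen_ball f y C \<delta> \<in> sets \<mu>" if "C \<in> words m" for y C \<delta>
    using that \<mu>(2) cont open_bowen_ball[of C f] by (auto simp: words_def subset_eq)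
  have "emeasure \<mu> (\<Union>p\<in>\<Gamma>. ?A p) \<le> (\<Sum>\<^sub>\<infinity>(C, y)\<in>\<Gamma>. ennreal (exp (- s * real (length C))))"
  proof (rule emeasure_UN_le_infsum[OF cov(1)])
    fix p assume p: "p \<in> \<Gamma>"
    obtain C y where [simp]: "p = (C, y)" by (cases p)
    have C: "C \<in> words m" "N \<le> length C" using cov(2) p by auto
    show "?A p \<in> sets \<mu>" using sets C by auto
    have "emeasure \<mu> (bowen_ball f y C (\<epsilon> / 2)) \<le> ennreal (exp (- s * real (length C)))"
      if x: "x \<in> bowen_ball f y C (\<epsilon> / 2)" "x \<in> A" for x
    proof -
      have "emeasure \<mu> (bowen_ball f y C (\<epsilon> / 2)) \<le> emeasure \<mu> (bowen_ball f x C \<epsilon>)"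
        by (intro emeasure_mono bowen_ball_half_subset x sets C)
      also have "\<dots> \<le> ennreal (exp (- s * real (length C)))"
        unfolding emeasure_eq_measure by (intro ennreal_leI small x C)
      finally show ?thesis .
    qed
    then show "emeasure \<mu> (?A p) \<le> (case p of (C, y) \<Rightarrow> ennreal (exp (- s * real (length C))))"
      by auto
  qed
  moreover have "c \<le> emeasure \<mu> (\<Union>p\<in>\<Gamma>. ?A p)"
  proof (rule outer)
    show "(\<Union>p\<in>\<Gamma>. ?A p) \<in> sets \<mu>"
      using cov(1,2) sets by (intro sets.countable_UN') auto
    show "A \<subseteq> (\<Union>p\<in>\<Gamma>. ?A p)"
    proof
      fix x assume "x \<in> A"
      then obtain C y where "(C, y) \<in> \<Gamma>" "x \<in> bowen_ball f y C (\<epsilon> / 2)"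
        using cov(3) \<open>A \<subseteq> Y\<close> by blast
      with \<open>x \<in> A\<close> show "x \<in> (\<Union>p\<in>\<Gamma>. ?A p)" by (intro UN_I[of "(C, y)"]) auto
    qed
  qed
  ultimately show "c \<le> (\<Sum>\<^sub>\<infinity>(C, y)\<in>\<Gamma>. ennreal (exp (- s * real (length C))))" by order
qed

section \<open>Trajectories compared with words\<close>

text \<open>Pairing each centre with the initial word of \<open>\<omega>\<close> of length
  \<open>\<nu> y\<close> gives an amalgamated cover of equal weight; \<open>N \<ge> 1\<close> keeps
  these words nonempty.\<close>

lemma M_amalg_le_M_along:
  assumes \<omega>: "\<omega> \<in> trajectories m" and "N \<ge> 1"
  shows "M_amalg m f s Y N \<epsilon> \<le> M_along f \<omega> s Y N \<epsilon>"
  unfolding M_along_def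
proof (rule INF_greatest, clarify)
  fix \<Gamma> \<nu> assume "(\<Gamma>, \<nu>) \<in> covers_along f \<omega> Y N \<epsilon>"
  then have cov: "countable \<Gamma>" "\<And>y. y \<in> \<Gamma> \<Longrightarrow> N \<le> \<nu> y"
    "Y \<subseteq> (\<Union>y\<in>\<Gamma>. bowen_ball f y (map \<omega> [0..<\<nu> y]) \<epsilon>)"
    by (auto simp: covers_along_def bowen_ball_along_def)
  let ?h = "\<lambda>y. (map \<omega> [0..<\<nu> y], y)"
  have "map \<omega> [0..<\<nu> y] \<in> words m" if "y \<in> \<Gamma>" for y
    using \<omega> cov(2)[OF that] \<open>N \<ge> 1\<close> by (auto simp: words_def trajectories_def)
  then have "?h ` \<Gamma> \<in> covers_amalg m f Y N \<epsilon>"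
    using cov by (auto simp: covers_amalg_def)
  then have "M_amalg m f s Y N \<epsilon> \<le> (\<Sum>\<^sub>\<infinity>(C, y)\<in>?h ` \<Gamma>. ennreal (exp (- s * real (length C))))"
    unfolding M_amalg_def by (rule INF_lower)
  also have "\<dots> = (\<Sum>\<^sub>\<infinity>y\<in>\<Gamma>. ennreal (exp (- s * real (\<nu> y))))"
    \<comment> \<open>\<open>?h\<close> is injective because it retains the centre.\<close>
    by (subst infsum_reindex) (auto simp: inj_on_def o_def)
  finally show "M_amalg m f s Y N \<epsilon> \<le> (\<Sum>\<^sub>\<infinity>y\<in>\<Gamma>. ennreal (exp (- s * real (\<nu> y))))" .
qed

lemma entropy_amalg_le_entropy_along:
  assumes "\<omega> \<in> trajectories m"
  shows "entropy_amalg m f Y \<le> entropy_along f \<omega> Y"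
proof (rule tendsto_le[OF _ entropy_along_eps_tendsto entropy_amalg_eps_tendsto])
  have "m_amalg m f s Y \<epsilon> \<le> m_along f \<omega> s Y \<epsilon>" for s \<epsilon>
    by (rule LIMSEQ_le[OF M_amalg_tendsto M_along_tendsto]) (use M_amalg_le_M_along[OF assms] in blast)
  \<comment> \<open>Fewer exponents make \<open>m_along\<close> vanish, so their infimum is
    larger.\<close>
  then have "m_along f \<omega> s Y \<epsilon> = 0 \<Longrightarrow> m_amalg m f s Y \<epsilon> = 0" for s \<epsilon>
    by (metis le_zero_eq)
  then show "\<forall>\<^sub>F \<epsilon> in at_right 0. entropy_amalg_eps m f Y \<epsilon> \<le> entropy_along_eps f \<omega> Y \<epsilon>"
    unfolding entropy_amalg_eps_def entropy_along_eps_def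
    by (intro always_eventually allI Inf_superset_mono) auto
qed simp

text \<open>The entropy at scale \<open>\<epsilon>\<close> grows as \<open>\<epsilon>\<close>
  decreases, so a lower bound at one scale suffices.\<close>

lemma entropy_amalg_eps_le_entropy_amalg:
  assumes "\<epsilon> > 0"
  shows "entropy_amalg_eps m f Y \<epsilon> \<le> entropy_amalg m f Y"
proof (rule tendsto_lowerbound[OF entropy_amalg_eps_tendsto])
  have "\<forall>\<^sub>F x in at_right 0. x \<in> {0<..<\<epsilon>}" using assms eventually_at_right_real by blast
  then show "\<forall>\<^sub>F x in at_right 0. entropy_amalg_eps m f Y \<epsilon> \<le> entropy_amalg_eps m f Y x"
    by eventually_elim (auto intro: entropy_amalg_eps_antimono)
qed simp

lemma entropy_amalg_ge:
  fixes f :: "nat \<Rightarrow> 'a::metric_space \<Rightarrow> 'a"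
  assumes \<mu>: "prob_space \<mu>" "sets \<mu> = sets borel"
    and cont: "\<And>i. i \<in> {1..m} \<Longrightarrow> continuous_on UNIV (f i)"
    and Y: "measure \<mu> Y > 0"
    and t: "\<And>x. x \<in> Y \<Longrightarrow> ereal t < lower_local_entropy \<mu> m f x"
  shows "ereal t \<le> entropy_amalg m f Y"
proof -
  interpret prob_space \<mu> by fact
  define A where "A k = {x \<in> Y. \<forall>C\<in>words m. k \<le> length C \<longrightarrow>
      measure \<mu> (bowen_ball f x C (1 / Suc k)) \<le> exp (- t * real (length C))}" for k
  have "Y \<subseteq> (\<Union>k. A k)"
    using lower_local_entropy_imp_bowen_ball_le[OF \<mu> cont t] by (auto simp: A_def)
  moreover have "emeasure \<mu> Y > 0" using Y by (simp add: emeasure_eq_measure)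
  ultimately obtain k c where c: "c > 0" "\<And>U. U \<in> sets \<mu> \<Longrightarrow> A k \<subseteq> U \<Longrightarrow> c \<le> emeasure \<mu> U"
    using positive_outer_measure_piece by metis
  define \<epsilon> where "\<epsilon> = 1 / real (Suc k)"
  \<comment> \<open>All \<open>s \<le> t\<close> are treated, since every such exponent must be
    excluded from the set whose infimum defines the entropy at scale
    \<open>\<epsilon> / 2\<close>.\<close>
  have M: "c \<le> M_amalg m f s Y N (\<epsilon> / 2)" if "s \<le> t" "k \<le> N" for s N
  proof (rule mass_distribution_M_amalg[OF finite_measure_axioms \<mu>(2) cont _ c(2)])
    fix x C assume "x \<in> A k" "C \<in> words m" "N \<le> length C"
    then have "measure \<mu> (bowen_ball f x C \<epsilon>) \<le> exp (- t * real (length C))"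
      using \<open>k \<le> N\<close> by (auto simp: A_def \<epsilon>_def)
    also have "\<dots> \<le> exp (- s * real (length C))"
      using \<open>s \<le> t\<close> by (simp add: mult_right_mono)
    finally show "measure \<mu> (bowen_ball f x C \<epsilon>) \<le> exp (- s * real (length C))" .
  qed (auto simp: A_def)
  have "c \<le> m_amalg m f s Y (\<epsilon> / 2)" if "s \<le> t" for s
    using M[OF that] by (intro LIMSEQ_le_const[OF M_amalg_tendsto]) blast
  then have "t < s" if "m_amalg m f s Y (\<epsilon> / 2) = 0" for s
    using that c(1) by (metis leD not_le)
  then have "ereal t \<le> entropy_amalg_eps m f Y (\<epsilon> / 2)"
    unfolding entropy_amalg_eps_def by (intro Inf_greatest) (auto intro: less_imp_le)
  also have "\<dots> \<le> entropy_amalg m f Y" by (rule entropy_amalg_eps_le_entropy_amalg) (simp add: \<epsilon>_def)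
  finally show ?thesis .
qed

theorem theorem6p2:
  fixes f :: "nat \<Rightarrow> 'a::metric_space \<Rightarrow> 'a" and m :: nat
    and \<mu> :: "'a measure" and Y :: "'a set" and \<alpha> :: real
  assumes "compact (UNIV :: 'a set)"
    and "m \<ge> 1"
    and "\<And>i. i \<in> {1..m} \<Longrightarrow> continuous_on UNIV (f i)"
    and "prob_space \<mu>" and "sets \<mu> = sets borel"
    and "Y \<in> sets borel" and "measure \<mu> Y > 0"
    and "\<alpha> > 0"
    and "\<And>x. x \<in> Y \<Longrightarrow> lower_local_entropy \<mu> m f x \<ge> ereal \<alpha>"
  shows "(\<forall>\<omega>\<in>trajectories m. entropy_along f \<omega> Y \<ge> ereal \<alpha>) \<and> entropy_amalg m f Y \<ge> ereal \<alpha>"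
proof -
  \<comment> \<open>The weak bound \<open>\<alpha>\<close> becomes strict for each
    \<open>t < \<alpha>\<close>; density of the reals then recovers \<open>\<alpha>\<close>.\<close>
  have "ereal t \<le> entropy_amalg m f Y" if "t < \<alpha>" for t
  proof (rule entropy_amalg_ge[OF assms(4,5,3,7)])
    show "ereal t < lower_local_entropy \<mu> m f x" if "x \<in> Y" for x
      using assms(9)[OF that] \<open>t < \<alpha>\<close> by (meson ereal_less(2) less_ereal.simps(1) less_le_trans)
  qed
  moreover have "\<exists>t<\<alpha>. x < ereal t" if "x < ereal \<alpha>" for x
    using ereal_dense2[OF that] by auto
  ultimately have "ereal \<alpha> \<le> entropy_amalg m f Y"
    by (meson less_le_trans not_le order_less_irrefl)
  then show ?thesis using entropy_amalg_le_entropy_along order_trans by blast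
qed

end
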